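(* Neither (OSC-D) nor (OSC-N) implies the other: with $I=(0,1)$, there exist $T>0$ and a measurable set $G\subset[0,T]\times I$ that satisfies (OSC-N) but not (OSC-D), and there exist $T>0$ and a measurable set $G\subset[0,T]\times I$ that satisfies (OSC-D) but not (OSC-N).
   Context: Labelled double cover. $\widetilde I=I\times\{\xi,\eta\}$ with the natural Lebesgue measure $|\cdot|$, so $|\widetilde I|=2$. Its points are written $[x;\sigma]$, $x\in I$, $\sigma\in\{\xi,\eta\}$. Characteristics. $L_{[x;\xi]}$ (resp. $L_{[x;\eta]}$) is the characteristic line in $\{t\ge0\}$ starting from $(t,x)=(0,x)$ and moving initially to the right (resp. left) with unit speed, reflecting at the boundary points $x=0$ and $x=1$. Explicitly, with the $2$-periodic folding map $\pi:\mathbb R\to[0,1]$, $\pi(s)=s$ for $0\le s\le1$ and $\pi(s)=2-s$ for $1<s<2$, $L_{[x;\xi]}=\{(s,\pi(x+s)):s\ge0\}$ and $L_{[x;\eta]}=\{(s,\pi(x-s)):s\ge0\}$. Intersection sets. For $\widetilde A\subset\widetilde I$, $$\mathcal M_{\widetilde A}=\{(t,x)\in[0,\infty)\times I:\ \exists\text{ distinct }\widetilde y,\widetilde z\in\widetilde A\text{ with }(t,x)\in L_{\widetilde y}\cap L_{\widetilde z}\},\qquad \mathcal M_{\widetilde A}(\tau)=\mathcal M_{\widetilde A}\cap\{t\le\tau\}.$$ For disjoint $\widetilde E,\widetilde F\subset\widetilde I$, $$\mathcal W_{\widetilde E,\widetilde F}=\{(t,x)\in[0,\infty)\times I:\ \exists\,\widetilde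 y\in\widetilde E,\ \widetilde z\in\widetilde F,\ \widetilde y\ne\widetilde z,\text{ with }(t,x)\in L_{\widetilde y}\cap L_{\widetilde z}\},\qquad \mathcal W_{\widetilde E,\widetilde F}(\tau)=\mathcal W_{\widetilde E,\widetilde F}\cap\{t\le\tau\}.$$ (OSC-D). For measurable $\widetilde A\subset\widetilde I$, $G$ is $(\widetilde A;T)$-observable symmetric if $G\setminus(\mathcal M_{\widetilde A}(T)\cup\mathcal M_{\widetilde I\setminus\widetilde A}(T))$ has two-dimensional Lebesgue measure $0$. $\widetilde A$ is trivial if $|\widetilde A|=0$ or $|\widetilde A|=2$, and nontrivial otherwise. $G\subset[0,T]\times I$ satisfies (OSC-D) if for every nontrivial measurable $\widetilde A\subset\widetilde I$, $G$ is not $(\widetilde A;T)$-observable symmetric. (OSC-N). For disjoint measurable $\widetilde E,\widetilde F\subset\widetilde I$, $G$ is $(\widetilde E,\widetilde F;T)$-observable symmetric if $G\setminus(\mathcal W_{\widetilde E,\widetilde F}(T)\cup\mathcal M_{\widetilde I\setminus(\widetilde E\cup\widetilde F)}(T))$ has two-dimensional Lebesgue measure $0$. The pair $(\widetilde E,\widetilde F)$ is trivial if $|\widetilde E|=0$ or $|\widetilde F|=0$, and nontrivial otherwise. $G\subset[0,T]\times I$ satisfies (OSC-N) if for every nontrivial pair of disjoint measurable sets $(\widetilde E,\widetilde F)$, $G$ is not $(\widetilde E,\widetilde F;T)$-observable symmetric. *)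

theory Defs
  imports "HOL-Analysis.Analysis"
begin

datatype label = Xi | Eta

lemma UNIV_label: "(UNIV :: label set) = {Xi, Eta}"
  by (auto intro: label.exhaust)

instance label :: finite
  by standard (simp add: UNIV_label)

abbreviation unit_int :: "real set" where
  "unit_int \<equiv> {0<..<1}"

text \<open>A point \<open>[x; \<sigma>]\<close> of the labelled double cover is the pair \<open>(x, \<sigma>)\<close>. As there are only two
  labels, the product below consists exactly of the sets both of whose sections are Lebesgue
  measurable, with the sum of the lengths of the two sections as measure.\<close>

definition cover :: "(real \<times> label) set" where
  "cover = unit_int \<times> UNIV"

definition cover_measure :: "(real \<times> label) measure" where
  "cover_measure = lebesgue_on unit_int \<Otimes>\<^sub>M count_space UNIV"

lemma space_cover_measure: "space cover_measure = cover"
  by (simp add: cover_measure_def cover_def space_pair_measure)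

lemma emeasure_cover: "emeasure cover_measure cover = 2"
proof -
  interpret C: sigma_finite_measure "count_space (UNIV :: label set)"
    by (rule sigma_finite_measure_count_space_finite) simp
  have "emeasure (lebesgue_on unit_int) unit_int = 1"
    by (simp add: emeasure_restrict_space)
  moreover have "unit_int \<in> sets (lebesgue_on unit_int)"
    by (simp add: sets_restrict_space_iff)
  ultimately show ?thesis
    unfolding cover_measure_def cover_def
    by (subst C.emeasure_pair_measure_Times) (auto simp: UNIV_label)
qed

definition fold_map :: "real \<Rightarrow> real" where
  "fold_map s = (let r = s - 2 * of_int \<lfloor>s / 2\<rfloor> in if r \<le> 1 then r else 2 - r)"

lemma fold_map_periodic: "fold_map (s + 2) = fold_map s"
  by (simp add: fold_map_def add_divide_distrib Let_def)

lemma fold_map_low: "0 \<le> s \<Longrightarrow> s \<le> 1 \<Longrightarrow> fold_map s = s"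
proof -
  assume "0 \<le> s" "s \<le> 1"
  then have "\<lfloor>s / 2\<rfloor> = 0" by (intro floor_unique) auto
  then show ?thesis using \<open>s \<le> 1\<close> by (simp add: fold_map_def)
qed

lemma fold_map_high: "1 < s \<Longrightarrow> s < 2 \<Longrightarrow> fold_map s = 2 - s"
proof -
  assume "1 < s" "s < 2"
  then have "\<lfloor>s / 2\<rfloor> = 0" by (intro floor_unique) auto
  then show ?thesis using \<open>1 < s\<close> by (simp add: fold_map_def)
qed

fun char_line :: "real \<times> label \<Rightarrow> (real \<times> real) set" where
  "char_line (x, Xi) = {(s, fold_map (x + s)) | s. 0 \<le> s}"
| "char_line (x, Eta) = {(s, fold_map (x - s)) | s. 0 \<le> s}"

definition M_set :: "(real \<times> label) set \<Rightarrow> (real \<times> real) set" where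
  "M_set A = {p \<in> {0..} \<times> unit_int.
     \<exists>y\<in>A. \<exists>z\<in>A. y \<noteq> z \<and> p \<in> char_line y \<inter> char_line z}"

definition M_upto :: "(real \<times> label) set \<Rightarrow> real \<Rightarrow> (real \<times> real) set" where
  "M_upto A \<tau> = M_set A \<inter> {(t, x). t \<le> \<tau>}"

definition W_set :: "(real \<times> label) set \<Rightarrow> (real \<times> label) set \<Rightarrow> (real \<times> real) set" where
  "W_set E F = {p \<in> {0..} \<times> unit_int.
     \<exists>y\<in>E. \<exists>z\<in>F. y \<noteq> z \<and> p \<in> char_line y \<inter> char_line z}"

definition W_upto ::
    "(real \<times> label) set \<Rightarrow> (real \<times> label) set \<Rightarrow> real \<Rightarrow> (real \<times> real) set" where
  "W_upto E F \<tau> = W_set E F \<inter> {(t, x). t \<le> \<tau>}"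

definition obs_symmetric_D :: "(real \<times> label) set \<Rightarrow> real \<Rightarrow> (real \<times> real) set \<Rightarrow> bool" where
  "obs_symmetric_D A T G \<longleftrightarrow> G - (M_upto A T \<union> M_upto (cover - A) T) \<in> null_sets lebesgue"

definition trivial_D :: "(real \<times> label) set \<Rightarrow> bool" where
  "trivial_D A \<longleftrightarrow> emeasure cover_measure A = 0 \<or> emeasure cover_measure A = 2"

definition OSC_D :: "real \<Rightarrow> (real \<times> real) set \<Rightarrow> bool" where
  "OSC_D T G \<longleftrightarrow>
     (\<forall>A \<in> sets cover_measure. \<not> trivial_D A \<longrightarrow> \<not> obs_symmetric_D A T G)"

definition obs_symmetric_N ::
    "(real \<times> label) set \<Rightarrow> (real \<times> label) set \<Rightarrow> real \<Rightarrow> (real \<times> real) set \<Rightarrow> bool" where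
  "obs_symmetric_N E F T G \<longleftrightarrow>
     G - (W_upto E F T \<union> M_upto (cover - (E \<union> F)) T) \<in> null_sets lebesgue"

definition trivial_N :: "(real \<times> label) set \<Rightarrow> (real \<times> label) set \<Rightarrow> bool" where
  "trivial_N E F \<longleftrightarrow> emeasure cover_measure E = 0 \<or> emeasure cover_measure F = 0"

definition OSC_N :: "real \<Rightarrow> (real \<times> real) set \<Rightarrow> bool" where
  "OSC_N T G \<longleftrightarrow>
     (\<forall>E \<in> sets cover_measure. \<forall>F \<in> sets cover_measure.
        E \<inter> F = {} \<longrightarrow> \<not> trivial_N E F \<longrightarrow> \<not> obs_symmetric_N E F T G)"

end

theory Submission
  imports Defs
begin

text \<open>For \<open>t \<le> 1\<close> every point \<open>(t, x)\<close> lies on at most two characteristics, and almost every pair of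
  characteristics meets exactly once up to time 1. So a subset of \<open>[0,1] \<times> I\<close> is a graph on the double
  cover; (OSC-D) says that this graph is connected, (OSC-N) that it has no bipartite component.
  The disjoint union of the complete graphs on the two labels has only non-bipartite components, while
  the complete bipartite graph between the two labels is connected.\<close>

section \<open>Characteristics up to time 1\<close>

text \<open>The possible starting positions, with label \<open>\<sigma>\<close>, of the characteristics that pass through
  \<open>(t, x)\<close> moving to the right, respectively to the left.\<close>

fun foot_right :: "label \<Rightarrow> real \<times> real \<Rightarrow> real" where
  "foot_right Xi (t, x) = x - t"
| "foot_right Eta (t, x) = t - x"

fun foot_left :: "label \<Rightarrow> real \<times> real \<Rightarrow> real" where
  "foot_left Xi (t, x) = 2 - x - t"
| "foot_left Eta (t, x) = x + t"

lemma fold_map_between: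
  assumes "-1 < s" "s < 1"
  shows "fold_map s = \<bar>s\<bar>"
proof (cases "0 \<le> s")
  case True
  then show ?thesis using assms by (simp add: fold_map_low)
next
  case False
  then have "fold_map (s + 2) = 2 - (s + 2)"
    using assms by (intro fold_map_high) auto
  then show ?thesis using False by (simp add: fold_map_periodic)
qed

lemma fold_map_0_2:
  assumes "0 < s" "s < 2"
  shows "fold_map s = (if s \<le> 1 then s else 2 - s)"
  using assms by (simp add: fold_map_low fold_map_high)

text \<open>Up to time 1 a characteristic reflects at most once: the argument of
  \<open>fold_map\<close> stays in (0, 2) or (-1, 1). On either interval the map has two affine
  branches, and solving each of them for the starting position gives one foot.\<close>

lemma mem_char_line_iff:
  assumes "0 \<le> t" "t \<le> 1" "0 < x" "x < 1" "0 < a" "a < 1"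
  shows "(t, x) \<in> char_line (a, \<sigma>) \<longleftrightarrow> a = foot_right \<sigma> (t, x) \<or> a = foot_left \<sigma> (t, x)"
proof (cases \<sigma>)
  case Xi
  have "fold_map (a + t) = (if a + t \<le> 1 then a + t else 2 - (a + t))"
    using assms by (intro fold_map_0_2) auto
  then show ?thesis using Xi assms by auto
next
  case Eta
  have "fold_map (a - t) = \<bar>a - t\<bar>"
    using assms by (intro fold_map_between) auto
  then show ?thesis using Eta assms by auto
qed

text \<open>The two right feet are opposite numbers and the two left feet add up to 2, so at most
  one foot of each kind lies in the open unit interval.\<close>

lemma at_most_two_char_lines:
  assumes "0 \<le> t" "t \<le> 1" "0 < x" "x < 1"
    and "y \<in> cover" "z \<in> cover" "w \<in> cover" "y \<noteq> z"
    and "(t, x) \<in> char_line y" "(t, x) \<in> char_line z" "(t, x) \<in> char_line w"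
  shows "w = y \<or> w = z"
proof -
  obtain a \<alpha> b \<beta> c \<gamma> where yzw: "y = (a, \<alpha>)" "z = (b, \<beta>)" "w = (c, \<gamma>)"
    by (metis surj_pair)
  have *: "0 < a" "a < 1" "0 < b" "b < 1" "0 < c" "c < 1"
    using assms yzw by (auto simp: cover_def)
  then have "a = foot_right \<alpha> (t, x) \<or> a = foot_left \<alpha> (t, x)"
    "b = foot_right \<beta> (t, x) \<or> b = foot_left \<beta> (t, x)"
    "c = foot_right \<gamma> (t, x) \<or> c = foot_left \<gamma> (t, x)"
    using assms yzw mem_char_line_iff by blast+
  with * assms(1-4,8) yzw show ?thesis
    by (cases \<alpha>; cases \<beta>; cases \<gamma>; auto)
qed

text \<open>In the strip a right foot never exceeds a left foot, whatever the labels. This is why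
  the smaller position \<open>a\<close> is assigned to the line moving to the right.\<close>

lemma exists_crossing:
  assumes "0 < a" "a < b" "b < 1"
  shows "\<exists>t x. 0 \<le> t \<and> t \<le> 1 \<and> 0 < x \<and> x < 1 \<and>
    foot_right \<sigma> (t, x) = a \<and> foot_left \<tau> (t, x) = b"
proof -
  \<comment> \<open>For each pair of labels, \<open>t\<close> and \<open>x\<close> solve the two
    linear equations for the feet; \<open>0 < a < b < 1\<close> places the solution in the
    strip.\<close>
  define t where "t = (case (\<sigma>, \<tau>) of (Xi, Xi) \<Rightarrow> 1 - (a + b) / 2 | (Xi, Eta) \<Rightarrow> (b - a) / 2
    | (Eta, Xi) \<Rightarrow> 1 - (b - a) / 2 | (Eta, Eta) \<Rightarrow> (a + b) / 2)"
  define x where "x = (case (\<sigma>, \<tau>) of (Xi, Xi) \<Rightarrow> 1 - (b - a) / 2 | (Xi, Eta) \<Rightarrow> (a + b) / 2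
    | (Eta, Xi) \<Rightarrow> 1 - (a + b) / 2 | (Eta, Eta) \<Rightarrow> (b - a) / 2)"
  have "0 \<le> t \<and> t \<le> 1 \<and> 0 < x \<and> x < 1 \<and> foot_right \<sigma> (t, x) = a \<and> foot_left \<tau> (t, x) = b"
    unfolding t_def x_def using assms by (cases \<sigma>; cases \<tau>) (simp_all add: field_simps)
  then show ?thesis by blast
qed

lemma mem_W_uptoE:
  assumes "p \<in> W_upto E F 1"
  obtains t x y z where "p = (t, x)" "0 \<le> t" "t \<le> 1" "0 < x" "x < 1" "y \<in> E" "z \<in> F" "y \<noteq> z"
    "(t, x) \<in> char_line y" "(t, x) \<in> char_line z"
proof -
  obtain t x where "p = (t, x)" by (cases p)
  moreover from this obtain y z where "0 \<le> t" "t \<le> 1" "0 < x" "x < 1" "y \<in> E" "z \<in> F" "y \<noteq> z"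
    "(t, x) \<in> char_line y" "(t, x) \<in> char_line z"
    using assms unfolding W_upto_def W_set_def by fastforce
  ultimately show thesis by (rule that)
qed

section \<open>Intersection sets as edge sets of a graph\<close>

lemma M_upto_eq_W_upto: "M_upto A \<tau> = W_upto A A \<tau>"
  by (simp add: M_upto_def M_set_def W_upto_def W_set_def)

lemma W_upto_mono: "E \<subseteq> E' \<Longrightarrow> F \<subseteq> F' \<Longrightarrow> W_upto E F \<tau> \<subseteq> W_upto E' F' \<tau>"
  unfolding W_upto_def W_set_def by blast

text \<open>Up to time 1 a crossing point determines the unordered pair of its starting points. A
  common point would give one pair that is an edge for both families, and each alternative of the
  last assumption excludes this.\<close>

lemma W_upto_disjoint:
  assumes "E \<subseteq> cover" "F \<subseteq> cover" "E' \<subseteq> cover" "F' \<subseteq> cover"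
    and "E' \<inter> (E \<union> F) = {} \<or> F' \<inter> (E \<union> F) = {} \<or> E \<inter> (E' \<union> F') = {} \<or> F \<inter> (E' \<union> F') = {}"
  shows "W_upto E F 1 \<inter> W_upto E' F' 1 = {}"
proof -
  have False if "p \<in> W_upto E F 1" "p \<in> W_upto E' F' 1" for p
  proof -
    obtain t x y z where yz: "p = (t, x)" "0 \<le> t" "t \<le> 1" "0 < x" "x < 1" "y \<in> E" "z \<in> F" "y \<noteq> z"
      "(t, x) \<in> char_line y" "(t, x) \<in> char_line z"
      using \<open>p \<in> W_upto E F 1\<close> by (rule mem_W_uptoE)
    obtain t' x' y' z' where yz': "p = (t', x')" "y' \<in> E'" "z' \<in> F'" "y' \<noteq> z'"
      "(t', x') \<in> char_line y'" "(t', x') \<in> char_line z'"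
      using \<open>p \<in> W_upto E' F' 1\<close> by (rule mem_W_uptoE)
    have "y' = y \<or> y' = z" "z' = y \<or> z' = z"
      using at_most_two_char_lines[of t x y z y'] at_most_two_char_lines[of t x y z z'] yz yz' assms
      by auto
    then show False using assms(5) yz yz' by blast
  qed
  then show ?thesis by blast
qed

section \<open>Null sets\<close>

text \<open>Each factor differs by a null set from an F-sigma subset, which is Borel; for Borel
  factors the measure of the product is the product of the measures.\<close>

lemma not_negligible_Times:
  fixes P :: "'a::euclidean_space set" and Q :: "'b::euclidean_space set"
  assumes "P \<in> sets lebesgue" "Q \<in> sets lebesgue" "\<not> negligible P" "\<not> negligible Q"
  shows "\<not> negligible (P \<times> Q)"
proof
  assume neg: "negligible (P \<times> Q)"
  obtain C S where C: "fsigma C" "S \<in> null_sets lebesgue" "C \<union> S = P"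
    using lebesgue_set_almost_fsigma[OF assms(1)] by metis
  obtain D R where D: "fsigma D" "R \<in> null_sets lebesgue" "D \<union> R = Q"
    using lebesgue_set_almost_fsigma[OF assms(2)] by metis
  have borel: "C \<in> sets borel" "D \<in> sets borel"
    using C D by (auto elim!: fsigma.cases)
  then have CD: "C \<times> D \<in> sets borel" by (rule borel_Times)
  have "\<not> negligible C" "\<not> negligible D"
    using assms(3,4) C D by (metis negligible_Un negligible_iff_null_sets)+
  then have "emeasure lborel C \<noteq> 0" "emeasure lborel D \<noteq> 0"
    using borel by (auto simp: negligible_iff_null_sets null_sets_def emeasure_completion)
  moreover have "negligible (C \<times> D)"
    by (rule negligible_subset[OF neg]) (use C D in auto)
  then have "emeasure lborel (C \<times> D) = 0"
    using CD by (simp add: negligible_iff_null_sets null_sets_def)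
  moreover have "emeasure lborel (C \<times> D) = emeasure lborel C * emeasure lborel D"
    using borel by (simp add: lborel_prod[symmetric] lborel.emeasure_pair_measure_Times)
  ultimately show False by simp
qed

lemma differentiable_feet: "foot_right \<sigma> differentiable at p" "foot_left \<sigma> differentiable at p"
proof -
  have "foot_right \<sigma> = (\<lambda>p. case \<sigma> of Xi \<Rightarrow> snd p - fst p | Eta \<Rightarrow> fst p - snd p)"
    "foot_left \<sigma> = (\<lambda>p. case \<sigma> of Xi \<Rightarrow> 2 - snd p - fst p | Eta \<Rightarrow> snd p + fst p)"
    by (auto simp: fun_eq_iff split: label.split)
  moreover have "fst differentiable at p" "snd differentiable at p"
    by (auto intro: linear_imp_differentiable linear_fst linear_snd)
  ultimately show "foot_right \<sigma> differentiable at p" "foot_left \<sigma> differentiable at p"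
    by (cases \<sigma>; simp)+
qed

text \<open>A differentiable map from the plane to itself preserves null sets. Both orders of the
  feet occur because either starting point may belong to the line moving to the right.\<close>

lemma negligible_feet_image:
  assumes "negligible S"
  shows "negligible ((\<lambda>p. (foot_right \<sigma> p, foot_left \<tau> p)) ` S)"
    "negligible ((\<lambda>p. (foot_left \<sigma> p, foot_right \<tau> p)) ` S)"
  by (rule negligible_differentiable_image_negligible[OF order_refl assms],
      rule differentiable_at_imp_differentiable_on, rule differentiable_Pair;
      rule differentiable_feet)+

text \<open>The feet maps recover the two starting positions from a crossing point. If the crossing
  set were null, its two images would be null, although together with the diagonal they cover
  \<open>P \<times> Q\<close>.\<close>

lemma W_upto_Times_not_negligible:
  assumes PQ: "P \<subseteq> unit_int" "Q \<subseteq> unit_int" "P \<in> sets lebesgue" "Q \<in> sets lebesgue"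
    "\<not> negligible P" "\<not> negligible Q"
  shows "\<not> negligible (W_upto (P \<times> {\<sigma>}) (Q \<times> {\<tau>}) 1)"
proof
  let ?W = "W_upto (P \<times> {\<sigma>}) (Q \<times> {\<tau>}) 1"
  assume neg: "negligible ?W"
  \<comment> \<open>The diagonal, written as a hyperplane so that it is visibly null;
    \<open>exists_crossing\<close> speaks only of distinct positions.\<close>
  let ?D = "{p :: real \<times> real. (1, -1) \<bullet> p = 0}"
  let ?f = "\<lambda>p. (foot_right \<sigma> p, foot_left \<tau> p)"
  let ?g = "\<lambda>p. (foot_left \<sigma> p, foot_right \<tau> p)"
  have "(a, b) \<in> ?D \<union> ?f ` ?W \<union> ?g ` ?W" if ab: "a \<in> P" "b \<in> Q" for a b
  proof -
    have *: "0 < a" "a < 1" "0 < b" "b < 1" using ab PQ by auto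
    have W: "(t, x) \<in> ?W" if "0 \<le> t" "t \<le> 1" "0 < x" "x < 1" "a \<noteq> b"
      "(a, b) = ?f (t, x) \<or> (a, b) = ?g (t, x)" for t x
    proof -
      have "(t, x) \<in> char_line (a, \<sigma>)" "(t, x) \<in> char_line (b, \<tau>)"
        using that * mem_char_line_iff by auto
      then show ?thesis using that ab by (auto simp: W_upto_def W_set_def)
    qed
    have "\<exists>t x. 0 \<le> t \<and> t \<le> 1 \<and> 0 < x \<and> x < 1 \<and>
      ((a, b) = ?f (t, x) \<or> (a, b) = ?g (t, x))" if "a \<noteq> b"
    proof (cases "a < b")
      case True
      then show ?thesis using exists_crossing[of a b \<sigma> \<tau>] * by metis
    next
      case False
      then show ?thesis using exists_crossing[of b a \<tau> \<sigma>] * that by (metis linorder_neqE)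
    qed
    then have "(a, b) \<in> ?f ` ?W \<or> (a, b) \<in> ?g ` ?W" if "a \<noteq> b"
      using W that by (blast intro: image_eqI)
    then show ?thesis by (cases "a = b") auto
  qed
  then have "P \<times> Q \<subseteq> ?D \<union> ?f ` ?W \<union> ?g ` ?W"
    by (intro subrelI) (elim SigmaE2)
  moreover have "negligible (?D \<union> ?f ` ?W \<union> ?g ` ?W)"
    using neg by (intro negligible_Un negligible_feet_image negligible_hyperplane) (auto simp: zero_prod_def)
  ultimately show False
    using not_negligible_Times[OF PQ(3-6)] negligible_subset by blast
qed

section \<open>Measurable subsets of the cover and their sections\<close>

definition fibre :: "label \<Rightarrow> (real \<times> label) set \<Rightarrow> real set" where
  "fibre \<sigma> E = (\<lambda>x. (x, \<sigma>)) -` E"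

lemma fibre_measurable:
  assumes "E \<in> sets cover_measure"
  shows "fibre \<sigma> E \<in> sets lebesgue" "fibre \<sigma> E \<subseteq> unit_int"
proof -
  have "fibre \<sigma> E \<in> sets (lebesgue_on unit_int)"
    using assms unfolding cover_measure_def fibre_def by (rule sets_Pair2)
  then show "fibre \<sigma> E \<in> sets lebesgue" "fibre \<sigma> E \<subseteq> unit_int"
    by (auto simp: sets_restrict_space_iff)
qed

lemma subset_cover: "E \<in> sets cover_measure \<Longrightarrow> E \<subseteq> cover"
  using sets.sets_into_space space_cover_measure by metis

text \<open>The set is the finite union of its sections placed on their labels. Read
  contrapositively, a non-null set has a non-null section, to which planar measure theory
  applies.\<close>

lemma null_fibres:
  assumes E: "E \<in> sets cover_measure" and neg: "\<And>\<sigma>. negligible (fibre \<sigma> E)"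
  shows "E \<in> null_sets cover_measure"
proof -
  interpret C: sigma_finite_measure "count_space (UNIV :: label set)"
    by (rule sigma_finite_measure_count_space_finite) simp
  have "fibre \<sigma> E \<times> {\<sigma>} \<in> null_sets cover_measure" for \<sigma>
  proof -
    have F: "fibre \<sigma> E \<in> null_sets (lebesgue_on unit_int)"
      using neg[of \<sigma>] fibre_measurable[OF E, of \<sigma>]
      by (simp add: negligible_iff_null_sets null_sets_restrict_space)
    then show ?thesis
      unfolding cover_measure_def
      by (intro null_setsI) (auto simp: C.emeasure_pair_measure_Times null_sets_def)
  qed
  then have "(\<Union>\<sigma>\<in>UNIV. fibre \<sigma> E \<times> {\<sigma>}) \<in> null_sets cover_measure"
    by (intro null_sets_UN') (auto intro: countable_finite)
  moreover have "(\<Union>\<sigma>\<in>UNIV. fibre \<sigma> E \<times> {\<sigma>}) = E"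
    by (auto simp: fibre_def)
  ultimately show ?thesis by simp
qed

text \<open>Two non-null sets are joined by a non-null set of edges: restrict both to non-null
  sections. The case \<open>E\<close> = \<open>F\<close> says that a non-null set spans a non-null
  set of edges.\<close>

proposition W_upto_null_imp:
  assumes "E \<in> sets cover_measure" "F \<in> sets cover_measure" "W_upto E F 1 \<in> null_sets lebesgue"
  shows "E \<in> null_sets cover_measure \<or> F \<in> null_sets cover_measure"
proof (rule ccontr)
  assume "\<not> ?thesis"
  then obtain \<sigma> \<tau> where "\<not> negligible (fibre \<sigma> E)" "\<not> negligible (fibre \<tau> F)"
    using null_fibres assms by blast
  then have "\<not> negligible (W_upto (fibre \<sigma> E \<times> {\<sigma>}) (fibre \<tau> F \<times> {\<tau>}) 1)"
    using fibre_measurable assms by (intro W_upto_Times_not_negligible) auto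
  moreover have "negligible (W_upto (fibre \<sigma> E \<times> {\<sigma>}) (fibre \<tau> F \<times> {\<tau>}) 1)"
    using assms(3) by (rule negligible_subset[OF iffD2[OF negligible_iff_null_sets] W_upto_mono])
      (auto simp: fibre_def)
  ultimately show False by simp
qed

section \<open>The two examples\<close>

text \<open>For a symmetric pair, edges inside \<open>E\<close> are allowed neither as edges from
  \<open>E\<close> to \<open>F\<close> nor as edges outside \<open>E \<union> F\<close>. As the
  graph is complete on \<open>A\<close> and on its complement, \<open>E\<close> must be null on
  both.\<close>

lemma OSC_N_two_components:
  assumes A: "A \<in> sets cover_measure"
  shows "OSC_N 1 (M_upto A 1 \<union> M_upto (cover - A) 1)"
  unfolding OSC_N_def
proof (intro ballI impI notI)
  fix E F
  assume E: "E \<in> sets cover_measure" and F: "F \<in> sets cover_measure" and EF: "E \<inter> F = {}"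
    and nontriv: "\<not> trivial_N E F"
    and sym: "obs_symmetric_N E F 1 (M_upto A 1 \<union> M_upto (cover - A) 1)"
  have cA: "cover - A \<in> sets cover_measure"
    using A sets.compl_sets space_cover_measure by metis
  \<comment> \<open>Here \<open>B\<close> stands for either component, \<open>A\<close> or its
    complement.\<close>
  have null: "E \<inter> B \<in> null_sets cover_measure"
    if B: "B \<in> sets cover_measure" "M_upto B 1 \<subseteq> M_upto A 1 \<union> M_upto (cover - A) 1" for B
  proof -
    have EB: "E \<inter> B \<in> sets cover_measure" using E B by auto
    have "W_upto (E \<inter> B) (E \<inter> B) 1 \<subseteq> M_upto A 1 \<union> M_upto (cover - A) 1"
      using B(2) W_upto_mono[of "E \<inter> B" B "E \<inter> B" B 1] by (auto simp: M_upto_eq_W_upto)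
    moreover have "W_upto (E \<inter> B) (E \<inter> B) 1 \<inter> W_upto E F 1 = {}"
      using EF subset_cover[OF E] subset_cover[OF F] by (intro W_upto_disjoint) auto
    moreover have "W_upto (E \<inter> B) (E \<inter> B) 1 \<inter> M_upto (cover - (E \<union> F)) 1 = {}"
      unfolding M_upto_eq_W_upto using subset_cover[OF E] by (intro W_upto_disjoint) auto
    ultimately have "W_upto (E \<inter> B) (E \<inter> B) 1 \<subseteq>
        (M_upto A 1 \<union> M_upto (cover - A) 1) - (W_upto E F 1 \<union> M_upto (cover - (E \<union> F)) 1)"
      by blast
    then have "W_upto (E \<inter> B) (E \<inter> B) 1 \<in> null_sets lebesgue"
      using sym negligible_subset unfolding obs_symmetric_N_def negligible_iff_null_sets[symmetric]
      by blast
    then show ?thesis using W_upto_null_imp[OF EB EB] by blast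
  qed
  have "E \<inter> A \<union> E \<inter> (cover - A) \<in> null_sets cover_measure"
    using null[OF A] null[OF cA] by (intro null_sets.Un) auto
  moreover have "E \<inter> A \<union> E \<inter> (cover - A) = E" using subset_cover[OF E] by auto
  ultimately show False using nontriv by (auto simp: trivial_N_def null_sets_def)
qed

text \<open>For a symmetric \<open>B\<close>, almost no edge of the graph may cross from
  \<open>B\<close> to its complement. Each of the two ways to cross then has a null end, and every
  combination of null ends makes \<open>A\<close>, \<open>B\<close> or one of their complements
  null.\<close>

lemma OSC_D_complete_bipartite:
  assumes A: "A \<in> sets cover_measure" "A \<notin> null_sets cover_measure"
    "cover - A \<notin> null_sets cover_measure"
  shows "OSC_D 1 (W_upto A (cover - A) 1)"
  unfolding OSC_D_def
proof (intro ballI impI notI)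
  fix B
  assume B: "B \<in> sets cover_measure" and nontriv: "\<not> trivial_D B"
    and sym: "obs_symmetric_D B 1 (W_upto A (cover - A) 1)"
  have compl: "cover - S \<in> sets cover_measure" if "S \<in> sets cover_measure" for S
    using that sets.compl_sets space_cover_measure by metis
  note c = subset_cover[OF A(1)] subset_cover[OF B]
  have null: "A \<inter> C \<in> null_sets cover_measure \<or> (cover - A) \<inter> (cover - C) \<in> null_sets cover_measure"
    if C: "C \<in> {B, cover - B}" for C
  proof -
    let ?W = "W_upto (A \<inter> C) ((cover - A) \<inter> (cover - C)) 1"
    have CM: "C \<in> sets cover_measure" using C B compl by auto
    have "?W \<subseteq> W_upto A (cover - A) 1" by (intro W_upto_mono) auto
    \<comment> \<open>Every edge in \<open>?W\<close> has exactly one end in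
      \<open>B\<close>.\<close>
    moreover have "?W \<inter> M_upto B 1 = {}" "?W \<inter> M_upto (cover - B) 1 = {}"
      unfolding M_upto_eq_W_upto using c C by (intro W_upto_disjoint; auto)+
    ultimately have "?W \<subseteq> W_upto A (cover - A) 1 - (M_upto B 1 \<union> M_upto (cover - B) 1)"
      by blast
    then have "?W \<in> null_sets lebesgue"
      using sym negligible_subset unfolding obs_symmetric_D_def negligible_iff_null_sets[symmetric]
      by blast
    moreover have "A \<inter> C \<in> sets cover_measure" "(cover - A) \<inter> (cover - C) \<in> sets cover_measure"
      using A compl CM by auto
    ultimately show ?thesis using W_upto_null_imp by blast
  qed
  have union: "S \<in> null_sets cover_measure"
    if "S1 \<in> null_sets cover_measure" "S2 \<in> null_sets cover_measure" "S = S1 \<union> S2" for S S1 S2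
    using that null_sets.Un by auto
  have "B \<in> null_sets cover_measure \<or> cover - B \<in> null_sets cover_measure"
  proof -
    have "A \<inter> B \<in> null_sets cover_measure \<or> (cover - A) \<inter> (cover - B) \<in> null_sets cover_measure"
      "A \<inter> (cover - B) \<in> null_sets cover_measure \<or> (cover - A) \<inter> B \<in> null_sets cover_measure"
      using null[of B] null[of "cover - B"] c by (simp_all add: double_diff)
    moreover have "A = A \<inter> B \<union> A \<inter> (cover - B)" "B = A \<inter> B \<union> (cover - A) \<inter> B"
      "cover - A = (cover - A) \<inter> (cover - B) \<union> (cover - A) \<inter> B"
      "cover - B = (cover - A) \<inter> (cover - B) \<union> A \<inter> (cover - B)"
      using c by auto
    ultimately show ?thesis using union A(2,3) by metis
  qed
  moreover have "B \<notin> null_sets cover_measure"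
    using nontriv by (auto simp: trivial_D_def null_sets_def)
  \<comment> \<open>A null complement would give \<open>B\<close> the full measure 2, which is the
    other trivial case.\<close>
  moreover have "cover - B \<notin> null_sets cover_measure"
  proof
    assume "cover - B \<in> null_sets cover_measure"
    then have "emeasure cover_measure (B \<union> (cover - B)) = emeasure cover_measure B"
      using B by (intro emeasure_Un_null_set)
    then show False
      using nontriv c by (simp add: trivial_D_def Un_absorb1 emeasure_cover)
  qed
  ultimately show False by blast
qed

section \<open>The partition of the cover by label\<close>

definition half :: "label \<Rightarrow> (real \<times> label) set" where
  "half \<sigma> = unit_int \<times> {\<sigma>}"

lemma compl_half_Xi: "cover - half Xi = half Eta"
  using UNIV_label by (auto simp: cover_def half_def)

lemma half_measurable: "half \<sigma> \<in> sets cover_measure"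
  unfolding half_def cover_measure_def by (intro pair_measureI) (auto simp: sets_restrict_space_iff)

lemma emeasure_half: "emeasure cover_measure (half \<sigma>) = 1"
proof -
  interpret C: sigma_finite_measure "count_space (UNIV :: label set)"
    by (rule sigma_finite_measure_count_space_finite) simp
  have "emeasure cover_measure (half \<sigma>) = emeasure (lebesgue_on unit_int) unit_int * 1"
    unfolding half_def cover_measure_def
    by (subst C.emeasure_pair_measure_Times) (auto simp: sets_restrict_space_iff)
  also have "\<dots> = 1" by (simp add: emeasure_restrict_space)
  finally show ?thesis .
qed

lemma half_not_null: "half \<sigma> \<notin> null_sets cover_measure"
  by (simp add: null_sets_def emeasure_half)

text \<open>Describing the crossings by finitely many inequalities between continuous functions
  makes the two examples measurable.\<close>

lemma W_upto_halves:
  "W_upto (half \<sigma>) (half \<tau>) 1 = {p. 0 \<le> fst p \<and> fst p \<le> 1 \<and> 0 < snd p \<and> snd p < 1 \<and>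
    (0 < foot_right \<sigma> p \<and> foot_right \<sigma> p < 1 \<and> 0 < foot_left \<tau> p \<and> foot_left \<tau> p < 1 \<or>
    0 < foot_left \<sigma> p \<and> foot_left \<sigma> p < 1 \<and> 0 < foot_right \<tau> p \<and> foot_right \<tau> p < 1)}"
    (is "_ = ?S")
proof (intro subset_antisym subsetI)
  fix p
  assume "p \<in> W_upto (half \<sigma>) (half \<tau>) 1"
  then obtain t x y z where p: "p = (t, x)" "0 \<le> t" "t \<le> 1" "0 < x" "x < 1" "y \<in> half \<sigma>"
    "z \<in> half \<tau>" "y \<noteq> z" "(t, x) \<in> char_line y" "(t, x) \<in> char_line z"
    by (rule mem_W_uptoE)
  obtain a b where ab: "y = (a, \<sigma>)" "z = (b, \<tau>)" "0 < a" "a < 1" "0 < b" "b < 1"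
    using p(6,7) by (auto simp: half_def)
  with p(1-5,9,10) have "a = foot_right \<sigma> (t, x) \<or> a = foot_left \<sigma> (t, x)"
    "b = foot_right \<tau> (t, x) \<or> b = foot_left \<tau> (t, x)"
    using mem_char_line_iff by blast+
  \<comment> \<open>Two feet of the same direction are ruled out: with equal labels the starting
    points would coincide, with different labels the feet cannot both lie in the unit
    interval.\<close>
  with p ab show "p \<in> ?S"
    by (cases \<sigma>; cases \<tau>) auto
next
  fix p
  assume p: "p \<in> ?S"
  obtain t x where tx: "p = (t, x)" by (cases p)
  obtain a b where ab: "0 < a" "a < 1" "0 < b" "b < 1"
    "a = foot_right \<sigma> p \<and> b = foot_left \<tau> p \<or> a = foot_left \<sigma> p \<and> b = foot_right \<tau> p"
    using p by blast
  have "(t, x) \<in> char_line (a, \<sigma>)" "(t, x) \<in> char_line (b, \<tau>)"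
    using p ab tx by (auto simp: mem_char_line_iff)
  \<comment> \<open>With equal labels the left foot exceeds the right one by
    \<open>2 - 2 * x\<close> or \<open>2 * x\<close>, which is positive inside the interval.\<close>
  moreover have "(a, \<sigma>) \<noteq> (b, \<tau>)"
    using p ab tx by (cases \<sigma>; cases \<tau>) auto
  moreover have "(a, \<sigma>) \<in> half \<sigma>" "(b, \<tau>) \<in> half \<tau>" using ab by (auto simp: half_def)
  ultimately have "(t, x) \<in> W_set (half \<sigma>) (half \<tau>)"
    using p tx unfolding W_set_def by fastforce
  then show "p \<in> W_upto (half \<sigma>) (half \<tau>) 1"
    using p tx by (simp add: W_upto_def)
qed

lemma W_upto_halves_measurable: "W_upto (half \<sigma>) (half \<tau>) 1 \<in> sets lebesgue"
proof -
  have [measurable]: "foot_right \<rho> \<in> borel_measurable borel" "foot_left \<rho> \<in> borel_measurable borel"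
    for \<rho>
    by (intro borel_measurable_continuous_onI differentiable_imp_continuous_on
        differentiable_at_imp_differentiable_on differentiable_feet)+
  have [measurable]: "fst \<in> borel_measurable (borel :: (real \<times> real) measure)"
    "snd \<in> borel_measurable (borel :: (real \<times> real) measure)"
    by (intro borel_measurable_continuous_onI continuous_intros)+
  have "W_upto (half \<sigma>) (half \<tau>) 1 \<in> sets borel"
    unfolding W_upto_halves by measurable
  then show ?thesis by simp
qed

theorem mainTheorem5:
  shows "(\<exists>T>0. \<exists>G \<in> sets lebesgue. G \<subseteq> {0..T} \<times> {0<..<1} \<and> OSC_N T G \<and> \<not> OSC_D T G) \<and>
         (\<exists>T>0. \<exists>G \<in> sets lebesgue. G \<subseteq> {0..T} \<times> {0<..<1} \<and> OSC_D T G \<and> \<not> OSC_N T G)"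
proof (intro conjI)
  \<comment> \<open>Two complete graphs, one on each label: the partition by label leaves no point
    of \<open>?M\<close> over, so (OSC-D) fails.\<close>
  let ?M = "M_upto (half Xi) 1 \<union> M_upto (half Eta) 1"
  have "\<not> trivial_D (half Xi)"
    by (simp add: trivial_D_def emeasure_half)
  moreover have "obs_symmetric_D (half Xi) 1 ?M"
    by (simp add: obs_symmetric_D_def compl_half_Xi)
  ultimately have "\<not> OSC_D 1 ?M"
    using half_measurable unfolding OSC_D_def by blast
  moreover have "OSC_N 1 ?M"
    using OSC_N_two_components[OF half_measurable, of Xi] by (simp add: compl_half_Xi)
  moreover have "?M \<subseteq> {0..1} \<times> {0<..<1}" "?M \<in> sets lebesgue"
    using W_upto_halves_measurable by (auto simp: M_upto_eq_W_upto elim!: mem_W_uptoE)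
  ultimately show "\<exists>T>0. \<exists>G \<in> sets lebesgue. G \<subseteq> {0..T} \<times> {0<..<1} \<and> OSC_N T G \<and> \<not> OSC_D T G"
    using zero_less_one by blast
next
  \<comment> \<open>The complete bipartite graph between the labels: the pair of halves accounts for
    all of it, so (OSC-N) fails.\<close>
  let ?W = "W_upto (half Xi) (half Eta) 1"
  have "\<not> trivial_N (half Xi) (half Eta)"
    by (simp add: trivial_N_def emeasure_half)
  moreover have "obs_symmetric_N (half Xi) (half Eta) 1 ?W"
    by (simp add: obs_symmetric_N_def Diff_Un)
  moreover have "half Xi \<inter> half Eta = {}"
    by (auto simp: half_def)
  ultimately have "\<not> OSC_N 1 ?W"
    using half_measurable unfolding OSC_N_def by blast
  moreover have "OSC_D 1 ?W"
    using OSC_D_complete_bipartite[OF half_measurable, of Xi] half_not_null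
    by (simp add: compl_half_Xi)
  moreover have "?W \<subseteq> {0..1} \<times> {0<..<1}" "?W \<in> sets lebesgue"
    using W_upto_halves_measurable by (auto elim!: mem_W_uptoE)
  ultimately show "\<exists>T>0. \<exists>G \<in> sets lebesgue. G \<subseteq> {0..T} \<times> {0<..<1} \<and> OSC_D T G \<and> \<not> OSC_N T G"
    using zero_less_one by blast
qed

end
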